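(* Let $d\geqslant 1$ and $k\in\mathbb N_0$ be integers, let $\Omega\subset\mathbb R^d$ be a bounded open polyhedral set, $\mathcal T$ a conforming simplicial mesh of $\Omega$, and $\mathbb E$ a finite-dimensional real vector space with $m=\dim\mathbb E\geqslant1$, identified with $\mathbb R^m$ through a fixed basis. Let $M=\binom{d+k}{d}$. Then $\mathrm{NN}_d^m(k;2H_{\mathcal T},MN_{\mathcal T})$ realizes $\mathring{\mathcal V}_k^{\mathrm{DG}}(\mathcal T;\mathbb E)$ pointwise on $\overline\Omega$: every $\boldsymbol v\in\mathring{\mathcal V}_k^{\mathrm{DG}}(\mathcal T;\mathbb E)$ agrees at every point of $\overline\Omega$ with some member of $\mathrm{NN}_d^m(k;2H_{\mathcal T},MN_{\mathcal T})$. Moreover, for fixed $d$ and $k$, all hidden parameters $\boldsymbol W_{\mathrm I},\boldsymbol b_{\mathrm I},\boldsymbol W_{\mathrm{II},0},\boldsymbol W_{\mathrm{II},1},\boldsymbol b_{\mathrm{II}}$ depend only on the mesh, and only the output coefficients $\boldsymbol W_{\mathrm{III}}$ vary with the represented function.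
   Context: Mesh. $\Omega\subset\mathbb R^d$ is a bounded open polyhedral set, not necessarily convex or connected. A conforming simplicial mesh $\mathcal T=\{\tau_1,\dots,\tau_{N_{\mathcal T}}\}$ of $\Omega$ is a finite collection of pairwise disjoint open $d$-simplices $\tau_i\subset\Omega$ (elements) with $\bigcup_{\tau\in\mathcal T}\overline\tau=\overline\Omega$ such that for $i\neq j$ the set $\overline\tau_i\cap\overline\tau_j$ is either empty or a common subsimplex (face) of both. $N_{\mathcal T}$ is the number of elements. The skeleton is $\partial\mathcal T=\bigcup_{\tau\in\mathcal T}\partial\tau$. $H_{\mathcal T}$ is the number of distinct unoriented affine hyperplanes supporting the $(d-1)$-dimensional facets of elements (coplanar facets contribute only once). Function space. $\mathbb P_k(\tau;\mathbb E)=\mathbb P_k(\tau)\otimes\mathbb E$ denotes the $\mathbb E$-valued polynomials of total degree at most $k$ on $\tau$. $\mathring{\mathcal V}_k^{\mathrm{DG}}(\mathcal T;\mathbb E)$ is the space of functions $\boldsymbol v:\overline\Omega\to\mathbb E$ such that $\boldsymbol v|_\tau\in\mathbb P_k(\tau;\mathbb E)$ for every (open) $\tau\in\mathcal T$ and $\boldsymbol v=\boldsymbol 0$ on $\partial\mathcal T$. Networks. $\varrho_0(t)=\mathbf 1_{\{t>0\}}$ and $\varrho_j(t)=(\max\{t,0\})^j$ for $j\geqslant1$, applied componentwise to vectors. For positive integers $d,m,n_1,n_2$ and $k\in\mathbb N_0$, $\mathrm{NN}_d^m(k;n_1,n_2)$ is the class of functions $\mathbb R^d\to\mathbb R^m$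 of the form $$\boldsymbol x\mapsto\boldsymbol W_{\mathrm{III}}\,\varrho_k\big(\boldsymbol W_{\mathrm{II},0}\varrho_0(\boldsymbol W_{\mathrm I}\boldsymbol x+\boldsymbol b_{\mathrm I})+\boldsymbol W_{\mathrm{II},1}\varrho_1(\boldsymbol W_{\mathrm I}\boldsymbol x+\boldsymbol b_{\mathrm I})+\boldsymbol b_{\mathrm{II}}\big)$$ with $\boldsymbol W_{\mathrm I}\in\mathbb R^{n_1\times d}$, $\boldsymbol b_{\mathrm I}\in\mathbb R^{n_1}$, $\boldsymbol W_{\mathrm{II},0},\boldsymbol W_{\mathrm{II},1}\in\mathbb R^{n_2\times n_1}$, $\boldsymbol b_{\mathrm{II}}\in\mathbb R^{n_2}$, $\boldsymbol W_{\mathrm{III}}\in\mathbb R^{m\times n_2}$. All parameters other than $\boldsymbol W_{\mathrm{III}}$ are called hidden parameters; the entries of $\boldsymbol W_{\mathrm{III}}$ are the output coefficients. "Hidden parameters depend only on the mesh" means they can be chosen once, before $\boldsymbol v$, with only $\boldsymbol W_{\mathrm{III}}$ depending on $\boldsymbol v$. *)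

theory Defs
  imports "HOL-Analysis.Analysis"
begin

(* Convexity, connectedness and regularity (Omega = interior (closure Omega)) are not required. *)
definition bounded_open_polyhedral :: "(real ^ 'd) set \<Rightarrow> bool" where
  "bounded_open_polyhedral \<Omega> \<longleftrightarrow>
     bounded \<Omega> \<and> open \<Omega> \<and>
     (\<exists>\<P>. finite \<P> \<and> (\<forall>P\<in>\<P>. polytope P) \<and> closure \<Omega> = \<Union>\<P>)"

(* The library's simplices are closed; an open d-simplex is the interior of a d-simplex in R^d. *)
definition open_simplex :: "(real ^ 'd) set \<Rightarrow> bool" where
  "open_simplex \<tau> \<longleftrightarrow> (\<exists>S. int CARD('d) simplex S \<and> \<tau> = interior S)"

definition conforming_mesh :: "(real ^ 'd) set \<Rightarrow> (real ^ 'd) set set \<Rightarrow> bool" where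
  "conforming_mesh \<Omega> \<T> \<longleftrightarrow>
     finite \<T> \<and>
     (\<forall>\<tau>\<in>\<T>. open_simplex \<tau> \<and> \<tau> \<subseteq> \<Omega>) \<and>
     (\<forall>\<tau>\<in>\<T>. \<forall>\<sigma>\<in>\<T>. \<tau> \<noteq> \<sigma> \<longrightarrow> \<tau> \<inter> \<sigma> = {}) \<and>
     (\<Union>\<tau>\<in>\<T>. closure \<tau>) = closure \<Omega> \<and>
     (\<forall>\<tau>\<in>\<T>. \<forall>\<sigma>\<in>\<T>. \<tau> \<noteq> \<sigma> \<longrightarrow>
        closure \<tau> \<inter> closure \<sigma> = {} \<or>
        (closure \<tau> \<inter> closure \<sigma>) face_of closure \<tau> \<and>
        (closure \<tau> \<inter> closure \<sigma>) face_of closure \<sigma>)"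

definition skeleton :: "(real ^ 'd) set set \<Rightarrow> (real ^ 'd) set" where
  "skeleton \<T> = (\<Union>\<tau>\<in>\<T>. frontier \<tau>)"

(* Hyperplanes are point sets, hence unoriented, and coplanar facets contribute one element. *)
definition facet_hyperplanes :: "(real ^ 'd) set set \<Rightarrow> (real ^ 'd) set set" where
  "facet_hyperplanes \<T> = {affine hull F | F. \<exists>\<tau>\<in>\<T>. F facet_of closure \<tau>}"

definition multi_indices :: "nat \<Rightarrow> ('d::finite \<Rightarrow> nat) set" where
  "multi_indices k = {\<alpha>. (\<Sum>i\<in>UNIV. \<alpha> i) \<le> k}"

lemma finite_multi_indices: "finite (multi_indices k :: ('d::finite \<Rightarrow> nat) set)"
proof (rule finite_subset)
  show "(multi_indices k :: ('d \<Rightarrow> nat) set) \<subseteq> PiE UNIV (\<lambda>_. {..k})"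
  proof
    fix \<alpha> :: "'d \<Rightarrow> nat" assume "\<alpha> \<in> multi_indices k"
    moreover have "\<alpha> i \<le> (\<Sum>i\<in>UNIV. \<alpha> i)" for i
      by (rule member_le_sum) auto
    ultimately show "\<alpha> \<in> PiE UNIV (\<lambda>_. {..k})"
      by (auto simp: multi_indices_def intro: order_trans)
  qed
qed (auto intro: finite_PiE)

definition polynomial_on ::
  "nat \<Rightarrow> (real ^ 'd) set \<Rightarrow> 'e::real_vector set \<Rightarrow> (real ^ 'd \<Rightarrow> 'e) \<Rightarrow> bool" where
  "polynomial_on k \<tau> E v \<longleftrightarrow>
     (\<exists>c. (\<forall>\<alpha>\<in>multi_indices k. c \<alpha> \<in> E) \<and>
          (\<forall>x\<in>\<tau>. v x = (\<Sum>\<alpha>\<in>multi_indices k. (\<Prod>i\<in>UNIV. (x $ i) ^ \<alpha> i) *\<^sub>R c \<alpha>)))"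

(* Functions on closure Omega are total functions whose values elsewhere are unconstrained. *)
definition DG_space ::
  "nat \<Rightarrow> (real ^ 'd) set \<Rightarrow> (real ^ 'd) set set \<Rightarrow> 'e::real_vector set \<Rightarrow> (real ^ 'd \<Rightarrow> 'e) set" where
  "DG_space k \<Omega> \<T> E =
     {v. (\<forall>x\<in>closure \<Omega>. v x \<in> E) \<and> (\<forall>\<tau>\<in>\<T>. polynomial_on k \<tau> E v) \<and>
         (\<forall>x\<in>skeleton \<T>. v x = 0)}"

definition is_basis :: "nat \<Rightarrow> (nat \<Rightarrow> 'e::real_vector) \<Rightarrow> 'e set \<Rightarrow> bool" where
  "is_basis m b E \<longleftrightarrow>
     inj_on b {..<m} \<and> independent (b ` {..<m}) \<and> span (b ` {..<m}) = E"

definition rho :: "nat \<Rightarrow> real \<Rightarrow> real" where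
  "rho j t = (if j = 0 then (if t > 0 then 1 else 0) else (max t 0) ^ j)"

(* The layer widths depend on the mesh, so matrices and vectors are indexed by natural numbers:
   an n x n' matrix is a function nat => nat => real of which only the entries (i, j) with
   i < n and j < n' are used. The rows of WI are vectors in R^d, so WI i \<bullet> x is (WI x)_i.
   R^m is represented by the functions nat => real that vanish from index m on. *)
definition network ::
  "nat \<Rightarrow> nat \<Rightarrow> nat \<Rightarrow> nat \<Rightarrow> (nat \<Rightarrow> real ^ 'd) \<Rightarrow> (nat \<Rightarrow> real) \<Rightarrow>
   (nat \<Rightarrow> nat \<Rightarrow> real) \<Rightarrow> (nat \<Rightarrow> nat \<Rightarrow> real) \<Rightarrow> (nat \<Rightarrow> real) \<Rightarrow>
   (nat \<Rightarrow> nat \<Rightarrow> real) \<Rightarrow> real ^ 'd \<Rightarrow> nat \<Rightarrow> real" where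
  "network m k n1 n2 WI bI WII0 WII1 bII WIII x =
     (\<lambda>l. if l < m then
            (\<Sum>i<n2. WIII l i *
               rho k ((\<Sum>j<n1. WII0 i j * rho 0 (WI j \<bullet> x + bI j)) +
                      (\<Sum>j<n1. WII1 i j * rho 1 (WI j \<bullet> x + bI j)) + bII i))
          else 0)"

definition NN :: "nat \<Rightarrow> nat \<Rightarrow> nat \<Rightarrow> nat \<Rightarrow> (real ^ 'd \<Rightarrow> nat \<Rightarrow> real) set" where
  "NN m k n1 n2 =
     {network m k n1 n2 WI bI WII0 WII1 bII WIII | WI bI WII0 WII1 bII WIII. True}"

end

theory Submission
  imports Defs "HOL-Library.Function_Algebras"
begin

text \<open>
The network isolates one element \<tau> at a time. Each facet hyperplane {x. n.x = c} receives two
first-layer neurons, one for each orientation. Through rho 0 they report on which open side of the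
hyperplane x lies, and the difference of their rho 1 outputs is n.x - c. An element is the
intersection of the open half-spaces bounded by its facet hyperplanes, so the rho 0 outputs count
how many of its defining inequalities fail at x; and since an element is bounded, the normals of its
facets span R^d, so the rho 1 outputs generate all affine functions up to constants
(lemma polytope_facet_halfspaces). Take an affine function with values in the interval (0, 2] on
the closure of the domain and subtract twice the number of failed inequalities. The result is the
affine function on \<tau> and is not positive elsewhere in the closure, so rho k turns it into the k-th
power of the affine function on \<tau> and into 0 off \<tau> (lemma gated_power_neuron).

What remains is that M = (d + k choose d) such powers generate all polynomials of degree at most k.
The powers (1 + t.x)^k with t in an arbitrarily small box span every monomial, because a polynomial
in a parameter s that takes values in a linear subspace for all small s > 0 has its coefficients in
that subspace; extracting coefficients one coordinate of t at a time produces the monomials (lemma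
monomial_in_span_affine_powers). Counting dimensions, a basis of M or fewer such powers suffices
(lemma monomials_from_few_affine_powers), and it depends on k, d and a bound of the domain only.

With these powers attached to every element, a function of the space is matched on each element by
the output coefficients alone. At the remaining points of the closure, which lie on the skeleton,
the function is 0 and all second-layer neurons return 0 (lemma DG_space_expansion).
\<close>

section \<open>Polynomials spanned by powers of affine functions\<close>

text \<open>
Pointwise operations make the real functions on a set a vector space, so that span, independence
and the bound on the size of independent sets apply to spaces of polynomial functions.
\<close>

interpretation real_fun: vector_space "\<lambda>(c::real) (f::'a \<Rightarrow> real) x. c * f x"
  by unfold_locales (auto simp: fun_eq_iff algebra_simps)

lemma sum_fun_apply: "(\<Sum>i\<in>I. f i) x = (\<Sum>i\<in>I. f i x)"
  for f :: "'i \<Rightarrow> 'a \<Rightarrow> 'b::comm_monoid_add"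
  by (induction I rule: infinite_finite_induct) auto

text \<open>
Write p(s) for the sum. The combination 2^n p(s/2) - p(s) has no term of degree n and multiplies
each coefficient function of lower degree j by the nonzero number 2^(n - j) - 1. It stays in S for
all s in the range, because halving preserves the interval, so induction on n yields the lower
coefficients, and the top one is what remains of p.
\<close>

lemma coefficient_functions_in_subspace:
  fixes f :: "nat \<Rightarrow> 'a \<Rightarrow> real"
  assumes S: "real_fun.subspace S" and "\<epsilon> > 0"
    and "\<And>s. 0 < s \<Longrightarrow> s \<le> \<epsilon> \<Longrightarrow> (\<lambda>x. \<Sum>j\<le>n. s ^ j * f j x) \<in> S"
    and "j \<le> n"
  shows "f j \<in> S"
  using assms(3,4)
proof (induction n arbitrary: f j)
  case 0
  then show ?case using \<open>\<epsilon> > 0\<close> by auto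
next
  case (Suc n)
  note P = Suc.prems(1)
  define c where "c j = (2::real) ^ (Suc n - j) - 1" for j
  have lower: "f j \<in> S" if "j \<le> n" for j
  proof -
    have "(\<lambda>x. \<Sum>j\<le>n. s ^ j * (c j * f j x)) \<in> S" if s: "0 < s" "s \<le> \<epsilon>" for s
    proof -
      have step: "2 ^ Suc n * ((s / 2) ^ j * f j x) - s ^ j * f j x = s ^ j * (c j * f j x)"
        if "j \<le> Suc n" for j x
      proof -
        have "(2::real) ^ Suc n = 2 ^ (Suc n - j) * 2 ^ j"
          using that by (simp flip: power_add)
        then have "2 ^ Suc n * (s / 2) ^ j = 2 ^ (Suc n - j) * s ^ j"
          by (simp add: power_divide del: power_Suc)
        then have "2 ^ Suc n * ((s / 2) ^ j * f j x) = 2 ^ (Suc n - j) * s ^ j * f j x"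
          by (simp only: mult.assoc[symmetric])
        then show ?thesis
          by (simp only: c_def) (simp add: algebra_simps)
      qed
      have "(\<Sum>j\<le>n. s ^ j * (c j * f j x)) =
          2 ^ Suc n * (\<Sum>j\<le>Suc n. (s / 2) ^ j * f j x) - (\<Sum>j\<le>Suc n. s ^ j * f j x)" for x
      proof -
        have "2 ^ Suc n * (\<Sum>j\<le>Suc n. (s / 2) ^ j * f j x) - (\<Sum>j\<le>Suc n. s ^ j * f j x)
            = (\<Sum>j\<le>Suc n. s ^ j * (c j * f j x))"
          unfolding sum_distrib_left sum_subtractf[symmetric]
          by (rule sum.cong) (use step in auto)
        also have "\<dots> = (\<Sum>j\<le>n. s ^ j * (c j * f j x))"
          by (simp add: c_def)
        finally show ?thesis by simp
      qed
      moreover have "(\<lambda>x. 2 ^ Suc n * (\<Sum>j\<le>Suc n. (s / 2) ^ j * f j x)) \<in> S"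
        using real_fun.subspace_scale[OF S P[of "s / 2"], of "2 ^ Suc n"] s by simp
      from real_fun.subspace_diff[OF S this P[OF s]]
      have "(\<lambda>x. 2 ^ Suc n * (\<Sum>j\<le>Suc n. (s / 2) ^ j * f j x) - (\<Sum>j\<le>Suc n. s ^ j * f j x)) \<in> S"
        by (simp add: fun_diff_def)
      ultimately show ?thesis by simp
    qed
    from Suc.IH[of "\<lambda>j x. c j * f j x", OF this that]
    have "(\<lambda>x. c j * f j x) \<in> S" .
    from real_fun.subspace_scale[OF S this, of "inverse (c j)"]
    show ?thesis
    proof -
      have "(1::real) < 2 ^ (Suc n - j)" using that by (intro one_less_power) auto
      then have "c j \<noteq> 0" by (simp add: c_def)
      then show ?thesis
        using \<open>(\<lambda>x. inverse (c j) * (c j * f j x)) \<in> S\<close> by (simp flip: mult.assoc)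
    qed
  qed
  show ?case
  proof (cases "j \<le> n")
    case True
    then show ?thesis by (rule lower)
  next
    case False
    with Suc.prems have j: "j = Suc n" by simp
    have "(\<Sum>j\<le>n. (\<lambda>x. \<epsilon> ^ j * f j x)) \<in> S"
      by (intro real_fun.subspace_sum[OF S] real_fun.subspace_scale[OF S] lower) simp
    from real_fun.subspace_diff[OF S P[OF \<open>\<epsilon> > 0\<close> order_refl] this]
    have "(\<lambda>x. \<epsilon> ^ Suc n * f (Suc n) x) \<in> S"
      by (simp add: fun_diff_def sum_fun_apply)
    from real_fun.subspace_scale[OF S this, of "inverse (\<epsilon> ^ Suc n)"] \<open>\<epsilon> > 0\<close>
    show ?thesis by (simp add: j mult.assoc[symmetric] del: power_Suc)
  qed
qed

definition monomial_fun :: "('d::finite \<Rightarrow> nat) \<Rightarrow> real ^ 'd \<Rightarrow> real" where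
  "monomial_fun \<alpha> x = (\<Prod>i\<in>UNIV. (x $ i) ^ \<alpha> i)"

text \<open>
Confining t to a box makes the affine functions 1 + t.x as close to 1 as desired on a given bounded
set, by the choice of \<epsilon>.
\<close>

definition affine_powers :: "nat \<Rightarrow> real \<Rightarrow> (real ^ 'd \<Rightarrow> real) set" where
  "affine_powers k \<epsilon> = {\<lambda>x. (1 + t \<bullet> x) ^ k | t. \<forall>i. 0 \<le> t $ i \<and> t $ i \<le> \<epsilon>}"

text \<open>
The coordinates are treated one after the other. Once those in A are done, the span contains the
product of their powers with the remaining power of 1 + t.x, for every t vanishing on A. Moving t
along a new axis i by s turns 1 + t.x into s x_i + (1 + t.x), and the binomial theorem exhibits the
power of this sum as a polynomial in s whose coefficient at the exponent of x_i is the next product.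
At the end t = 0 is allowed and the affine factor is 1.
\<close>

lemma monomial_in_span_affine_powers:
  fixes \<alpha> :: "'d::finite \<Rightarrow> nat"
  assumes "\<epsilon> > 0" and \<alpha>: "\<alpha> \<in> multi_indices k"
  shows "monomial_fun \<alpha> \<in> real_fun.span (affine_powers k \<epsilon>)"
proof -
  let ?S = "real_fun.span (affine_powers k \<epsilon>) :: (real ^ 'd \<Rightarrow> real) set"
  have partial: "(\<lambda>x. (\<Prod>i\<in>A. (x $ i) ^ \<alpha> i) * (1 + t \<bullet> x) ^ (k - sum \<alpha> A)) \<in> ?S"
    if "\<forall>i. 0 \<le> t $ i \<and> t $ i \<le> \<epsilon>" "\<forall>i\<in>A. t $ i = 0" for A and t :: "real ^ 'd"
    using finite[of A] that
  proof (induction A arbitrary: t rule: finite_induct)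
    case empty
    then show ?case
      by (auto simp: affine_powers_def intro!: real_fun.span_base)
  next
    case (insert i A)
    define n where "n = k - sum \<alpha> A"
    define f where "f j x = (\<Prod>i\<in>A. (x $ i) ^ \<alpha> i) *
        (real (n choose j) * (x $ i) ^ j * (1 + t \<bullet> x) ^ (n - j))" for j and x :: "real ^ 'd"
    have "sum \<alpha> (insert i A) \<le> sum \<alpha> UNIV"
      by (rule sum_mono2) auto
    then have le: "\<alpha> i \<le> n"
      using \<alpha> insert.hyps by (auto simp: n_def multi_indices_def)
    have "f (\<alpha> i) \<in> ?S"
    proof (rule coefficient_functions_in_subspace[OF real_fun.subspace_span \<open>\<epsilon> > 0\<close> _ le])
      fix s :: real assume s: "0 < s" "s \<le> \<epsilon>"
      define t' where "t' = t + axis i s"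
      have t'x: "1 + t' \<bullet> x = s * (x $ i) + (1 + t \<bullet> x)" for x
        by (simp add: t'_def inner_add_left inner_axis')
      have "(\<lambda>x. (\<Prod>i\<in>A. (x $ i) ^ \<alpha> i) * (1 + t' \<bullet> x) ^ (k - sum \<alpha> A)) \<in> ?S"
        using insert.prems insert.hyps s
        by (intro insert.IH) (auto simp: t'_def axis_def)
      moreover have "(\<Prod>i\<in>A. (x $ i) ^ \<alpha> i) * (1 + t' \<bullet> x) ^ (k - sum \<alpha> A) =
          (\<Sum>j\<le>n. s ^ j * f j x)" for x
        unfolding t'x n_def[symmetric] binomial_ring[of "s * x $ i"]
        by (simp add: f_def sum_distrib_left power_mult_distrib mult_ac)
      ultimately show "(\<lambda>x. \<Sum>j\<le>n. s ^ j * f j x) \<in> ?S"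
        by simp
    qed
    from real_fun.span_scale[OF this, of "inverse (real (n choose \<alpha> i))"]
    show ?case
      using le insert.hyps by (simp add: f_def n_def mult_ac field_simps)
  qed
  from partial[of 0 UNIV] \<open>\<epsilon> > 0\<close> show ?thesis
    by (simp add: monomial_fun_def[abs_def])
qed

lemma affine_power_in_span_monomials:
  fixes t :: "real ^ 'd"
  shows "(\<lambda>x. (1 + t \<bullet> x) ^ k) \<in> real_fun.span (monomial_fun ` multi_indices k)"
proof (induction k)
  case 0
  have "monomial_fun (\<lambda>_. 0) \<in> real_fun.span (monomial_fun ` (multi_indices 0 :: ('d \<Rightarrow> nat) set))"
    by (intro real_fun.span_base imageI) (simp add: multi_indices_def)
  then show ?case by (simp add: monomial_fun_def[abs_def])
next
  case (Suc k)
  let ?S = "real_fun.span (monomial_fun ` (multi_indices (Suc k) :: ('d \<Rightarrow> nat) set))"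
  let ?U = "{f. (\<lambda>x. (1 + t \<bullet> x) * f x) \<in> ?S}"
  have "monomial_fun ` multi_indices k \<subseteq> ?U"
  proof safe
    fix \<alpha> :: "'d \<Rightarrow> nat" assume \<alpha>: "\<alpha> \<in> multi_indices k"
    have mono: "monomial_fun \<alpha> \<in> ?S"
      using \<alpha> by (intro real_fun.span_base imageI) (simp add: multi_indices_def)
    have "monomial_fun (\<alpha>(i := Suc (\<alpha> i))) \<in> ?S" for i
    proof (intro real_fun.span_base imageI)
      have "sum (\<alpha>(i := Suc (\<alpha> i))) UNIV = Suc (sum \<alpha> UNIV)"
        by (subst (1 2) sum.remove[of UNIV i]) auto
      then show "\<alpha>(i := Suc (\<alpha> i)) \<in> multi_indices (Suc k)"
        using \<alpha> by (simp add: multi_indices_def)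
    qed
    moreover have "monomial_fun (\<alpha>(i := Suc (\<alpha> i))) = (\<lambda>x. x $ i * monomial_fun \<alpha> x)" for i
      unfolding monomial_fun_def fun_eq_iff
      by (subst (1 2) prod.remove[of UNIV i]) (auto simp: mult_ac)
    ultimately have "(\<lambda>x. x $ i * monomial_fun \<alpha> x) \<in> ?S" for i
      by simp
    then have "monomial_fun \<alpha> + (\<Sum>i\<in>UNIV. (\<lambda>x. t $ i * (x $ i * monomial_fun \<alpha> x))) \<in> ?S"
      by (intro real_fun.span_add real_fun.span_sum mono real_fun.span_scale)
    moreover have "monomial_fun \<alpha> + (\<Sum>i\<in>UNIV. (\<lambda>x. t $ i * (x $ i * monomial_fun \<alpha> x))) =
        (\<lambda>x. (1 + t \<bullet> x) * monomial_fun \<alpha> x)"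
      by (auto simp: fun_eq_iff sum_fun_apply inner_vec_def algebra_simps sum_distrib_left)
    ultimately show "(\<lambda>x. (1 + t \<bullet> x) * monomial_fun \<alpha> x) \<in> ?S" by simp
  qed
  moreover have "real_fun.subspace ?U"
  proof (rule real_fun.subspaceI, goal_cases)
    case 1
    then show ?case using real_fun.span_zero[of "monomial_fun ` (multi_indices (Suc k) :: ('d \<Rightarrow> nat) set)"]
      by (simp add: zero_fun_def)
  next
    case (2 f g)
    then show ?case using real_fun.span_add[of "\<lambda>x. (1 + t \<bullet> x) * f x" _ "\<lambda>x. (1 + t \<bullet> x) * g x"]
      by (simp add: plus_fun_def distrib_left)
  next
    case (3 c f)
    then show ?case using real_fun.span_scale[of "\<lambda>x. (1 + t \<bullet> x) * f x" _ c]
      by (simp add: mult.left_commute)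
  qed
  ultimately have "real_fun.span (monomial_fun ` multi_indices k) \<subseteq> ?U"
    by (rule real_fun.span_minimal)
  with Suc.IH show ?case by auto
qed

text \<open>
Appending the slack k - |\<alpha>| turns a multi-index into a list of d + 1 numbers with sum k, and such
lists are counted by a binomial coefficient.
\<close>

lemma card_multi_indices_le:
  "card (multi_indices k :: ('d::finite \<Rightarrow> nat) set) \<le> (CARD('d) + k) choose CARD('d)"
proof -
  obtain idx :: "'d list" where idx: "set idx = UNIV" "distinct idx"
    using finite_distinct_list[OF finite[of "UNIV :: 'd set"]] by auto
  have len: "length idx = CARD('d)"
    using distinct_card[OF idx(2)] idx(1) by simp
  let ?f = "\<lambda>\<alpha> :: 'd \<Rightarrow> nat. map \<alpha> idx @ [k - sum \<alpha> UNIV]"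
  let ?L = "{l :: nat list. length l = Suc CARD('d) \<and> sum_list l = k}"
  have card: "card ?L = (CARD('d) + k) choose CARD('d)"
    using card_length_sum_list[of "Suc CARD('d)" k] binomial_symmetric[of k "k + CARD('d)"]
    by (simp add: add.commute)
  then have "card ?L > 0" by simp
  then have "finite ?L" using card_ge_0_finite by blast
  moreover have "inj_on ?f (multi_indices k)"
    using idx(1) by (auto simp: inj_on_def map_eq_conv)
  moreover have "?f ` multi_indices k \<subseteq> ?L"
    using idx len by (auto simp: multi_indices_def sum_list_distinct_conv_sum_set)
  ultimately have "card (multi_indices k :: ('d \<Rightarrow> nat) set) \<le> card ?L"
    by (intro card_inj_on_le)
  then show ?thesis using card by simp
qed

text \<open>
A basis of the span of all admissible powers can be chosen among the powers themselves. It is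
independent inside the span of the monomials of degree at most k, so it has no more members than
there are such monomials. This is where the number M of second-layer neurons per element comes from.
\<close>

lemma monomials_from_few_affine_powers:
  assumes "\<epsilon> > 0"
  obtains t :: "nat \<Rightarrow> real ^ 'd" and q :: "('d \<Rightarrow> nat) \<Rightarrow> nat \<Rightarrow> real"
  where "\<And>p i. 0 \<le> t p $ i \<and> t p $ i \<le> \<epsilon>"
    and "\<And>\<alpha> x. \<alpha> \<in> multi_indices k \<Longrightarrow>
      monomial_fun \<alpha> x = (\<Sum>p < (CARD('d) + k) choose CARD('d). q \<alpha> p * (1 + t p \<bullet> x) ^ k)"
proof -
  let ?G = "affine_powers k \<epsilon> :: (real ^ 'd \<Rightarrow> real) set"
  let ?M = "(CARD('d) + k) choose CARD('d)"
  obtain B where B: "B \<subseteq> ?G" "real_fun.independent B" "?G \<subseteq> real_fun.span B"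
    using real_fun.maximal_independent_subset[of ?G] by blast
  have "B \<subseteq> real_fun.span (monomial_fun ` multi_indices k)"
    using B(1) affine_power_in_span_monomials by (force simp: affine_powers_def)
  from real_fun.independent_span_bound[OF finite_imageI[OF finite_multi_indices] B(2) this]
  have finB: "finite B"
    and "card B \<le> card (monomial_fun ` (multi_indices k :: ('d \<Rightarrow> nat) set))"
    by auto
  note this(2)
  also have "\<dots> \<le> card (multi_indices k :: ('d \<Rightarrow> nat) set)"
    by (rule card_image_le[OF finite_multi_indices])
  also have "\<dots> \<le> ?M" by (rule card_multi_indices_le)
  finally have cardB: "card B \<le> ?M" .
  obtain g where g: "bij_betw g {..<card B} B"
    using ex_bij_betw_nat_finite[OF finB] by (auto simp: atLeast0LessThan)
  have "\<forall>f\<in>B. \<exists>t. (\<forall>i. 0 \<le> t $ i \<and> t $ i \<le> \<epsilon>) \<and> f = (\<lambda>x. (1 + t \<bullet> x) ^ k)"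
    using B(1) by (auto simp: affine_powers_def)
  then obtain T where T: "\<And>f i. f \<in> B \<Longrightarrow> 0 \<le> T f $ i \<and> T f $ i \<le> \<epsilon>"
      "\<And>f x. f \<in> B \<Longrightarrow> f x = (1 + T f \<bullet> x) ^ k"
    by metis
  \<comment> \<open>Indices beyond the basis are padded by the constant function 1, with coefficient 0.\<close>
  define t where "t p = (if p < card B then T (g p) else 0)" for p
  have gB: "g p \<in> B" if "p < card B" for p
    using g that by (auto simp: bij_betw_def)
  have "\<exists>q. \<forall>x. monomial_fun \<alpha> x = (\<Sum>p<?M. q p * (1 + t p \<bullet> x) ^ k)"
    if "\<alpha> \<in> multi_indices k" for \<alpha>
  proof -
    have "real_fun.span ?G \<subseteq> real_fun.span B"
      using B(3) real_fun.span_minimal[OF _ real_fun.subspace_span] by blast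
    with monomial_in_span_affine_powers[OF \<open>\<epsilon> > 0\<close> that]
    obtain u where u: "monomial_fun \<alpha> = (\<Sum>f\<in>B. (\<lambda>x. u f * f x))"
      by (auto simp: real_fun.span_finite[OF finB])
    have "monomial_fun \<alpha> x =
        (\<Sum>p<?M. (if p < card B then u (g p) else 0) * (1 + t p \<bullet> x) ^ k)" for x
    proof -
      have "monomial_fun \<alpha> x = (\<Sum>f\<in>B. u f * f x)"
        by (simp add: u sum_fun_apply)
      also have "\<dots> = (\<Sum>p<card B. u (g p) * g p x)"
        by (rule sum.reindex_bij_betw[OF g, symmetric])
      also have "\<dots> = (\<Sum>p<card B. (if p < card B then u (g p) else 0) * (1 + t p \<bullet> x) ^ k)"
        by (rule sum.cong) (auto simp: t_def T(2)[OF gB])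
      also have "\<dots> = (\<Sum>p<?M. (if p < card B then u (g p) else 0) * (1 + t p \<bullet> x) ^ k)"
        by (rule sum.mono_neutral_left) (use cardB in auto)
      finally show ?thesis .
    qed
    then show ?thesis by (intro exI allI)
  qed
  then obtain q where "\<And>\<alpha> x. \<alpha> \<in> multi_indices k \<Longrightarrow>
      monomial_fun \<alpha> x = (\<Sum>p<?M. q \<alpha> p * (1 + t p \<bullet> x) ^ k)"
    by metis
  moreover have "0 \<le> t p $ i \<and> t p $ i \<le> \<epsilon>" for p i
    using T(1) gB \<open>\<epsilon> > 0\<close> by (auto simp: t_def)
  ultimately show ?thesis using that by blast
qed

section \<open>Facet hyperplanes of a polytope\<close>

text \<open>
An irredundant family of half-spaces cutting out P has one member for each facet. A facet has
codimension 1, so it affinely spans the whole bounding hyperplane. The normals span the space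
because P is bounded: a vector w orthogonal to all of them would be a direction in which P never
ends.
\<close>

lemma polytope_facet_halfspaces:
  fixes P :: "'a::euclidean_space set"
  assumes P: "polytope P" and int: "interior P \<noteq> {}"
  obtains F and a :: "'a set \<Rightarrow> 'a" and b :: "'a set \<Rightarrow> real"
  where "finite F" "interior P = {x. \<forall>h\<in>F. a h \<bullet> x < b h}"
    "\<And>h. h \<in> F \<Longrightarrow> a h \<noteq> 0"
    "\<And>h. h \<in> F \<Longrightarrow> \<exists>C. C facet_of P \<and> affine hull C = {x. a h \<bullet> x = b h}"
    "span (a ` F) = UNIV"
proof -
  have hull: "affine hull P = UNIV"
    using int by (rule affine_hull_nonempty_interior)
  obtain F where F: "finite F" "P = affine hull P \<inter> \<Inter>F"
      "\<forall>h\<in>F. \<exists>a b. a \<noteq> 0 \<and> h = {x. a \<bullet> x \<le> b}"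
      "\<And>F'. F' \<subset> F \<Longrightarrow> P \<subset> affine hull P \<inter> \<Inter>F'"
    using polytope_imp_polyhedron[OF P] polyhedron_Int_affine_minimal[of P] by meson
  then obtain a b where ab: "\<And>h. h \<in> F \<Longrightarrow> a h \<noteq> 0 \<and> h = {x. a h \<bullet> x \<le> b h}"
    by metis
  have mem: "x \<in> P \<longleftrightarrow> (\<forall>h\<in>F. a h \<bullet> x \<le> b h)" for x
    using F(2) ab by (auto simp: hull)
  have "interior P = rel_interior P"
    using int by (simp add: rel_interior_nonempty_interior)
  also have "\<dots> = {x \<in> P. \<forall>h\<in>F. a h \<bullet> x < b h}"
    by (rule rel_interior_polyhedron_explicit[OF F(1,2) ab F(4)])
  finally have interior: "interior P = {x. \<forall>h\<in>F. a h \<bullet> x < b h}"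
    using mem by (auto intro: less_imp_le)
  have facet: "\<exists>C. C facet_of P \<and> affine hull C = {x. a h \<bullet> x = b h}" if "h \<in> F" for h
  proof (intro exI conjI)
    let ?C = "P \<inter> {x. a h \<bullet> x = b h}"
    show C: "?C facet_of P"
      using facet_of_polyhedron_explicit[OF F(1,2) ab F(4)] that by blast
    have "aff_dim P = DIM('a)"
      using hull by (simp add: aff_dim_eq_full)
    then have "aff_dim ?C = aff_dim {x. a h \<bullet> x = b h}"
      using C ab[OF that] by (simp add: facet_of_def)
    then show "affine hull ?C = {x. a h \<bullet> x = b h}"
      using aff_dim_eq_full_gen[of ?C "{x. a h \<bullet> x = b h}"]
      by (simp add: affine_hull_eq[THEN iffD2, OF affine_hyperplane])
  qed
  have "span (a ` F) = UNIV"
  proof (rule ccontr)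
    assume "span (a ` F) \<noteq> UNIV"
    then have "span (a ` F) \<subset> span UNIV" by auto
    then obtain w where w: "w \<noteq> 0" "\<And>y. y \<in> span (a ` F) \<Longrightarrow> orthogonal w y"
      using orthogonal_to_subspace_exists_gen by metis
    obtain y where y: "y \<in> P" using int interior_subset by blast
    have "y + s *\<^sub>R w \<in> P" for s
    proof -
      have "a h \<bullet> w = 0" if "h \<in> F" for h
        using w(2)[of "a h"] that by (simp add: span_base orthogonal_def inner_commute)
      then show ?thesis using y by (simp add: mem inner_add_right)
    qed
    moreover obtain R where R: "\<And>x. x \<in> P \<Longrightarrow> norm x \<le> R"
      using polytope_imp_bounded[OF P] by (auto simp: bounded_iff)
    ultimately have le: "norm (y + s *\<^sub>R w) \<le> R" for s by blast
    \<comment> \<open>The step s is long enough to carry y out of the ball of radius R whatever its direction.\<close>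
    define s where "s = (R + norm y + 1) / norm w"
    have "R \<ge> 0" using R[OF y] norm_ge_zero order_trans by blast
    then have "norm (s *\<^sub>R w) = R + norm y + 1"
      using w(1) by (simp add: s_def)
    moreover have "norm (s *\<^sub>R w) \<le> norm (y + s *\<^sub>R w) + norm y"
      using norm_triangle_ineq4[of "y + s *\<^sub>R w" y] by simp
    ultimately show False using le[of s] by linarith
  qed
  with F(1) interior ab facet show ?thesis by (intro that) auto
qed

text \<open>
Each facet hyperplane gets a single equation, shared by all elements that touch it. This lemma
relates that equation to the one which a particular element prescribes; the sign of r tells on which
side of the hyperplane the element lies.
\<close>

lemma hyperplane_equations_proportional:
  fixes a n :: "'a::real_inner"
  assumes eq: "{x. a \<bullet> x = b} = {x. n \<bullet> x = c}" and "a \<noteq> 0" "n \<noteq> 0"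
  obtains r where "r \<noteq> 0" "a = r *\<^sub>R n" "b = r * c"
proof -
  \<comment> \<open>The vector x is a point of the hyperplane and y is the part of a orthogonal to n. As x + y also
    lies on the hyperplane, y is orthogonal to a as well, so it is zero.\<close>
  define r where "r = (a \<bullet> n) / (n \<bullet> n)"
  define x where "x = (c / (n \<bullet> n)) *\<^sub>R n"
  define y where "y = a - r *\<^sub>R n"
  have "n \<bullet> x = c" using \<open>n \<noteq> 0\<close> by (simp add: x_def)
  moreover have ny: "n \<bullet> y = 0"
    using \<open>n \<noteq> 0\<close> by (simp add: y_def r_def inner_diff_right inner_commute)
  ultimately have "x \<in> {x. n \<bullet> x = c}" "x + y \<in> {x. n \<bullet> x = c}"
    by (simp_all add: inner_add_right)
  then have ax: "a \<bullet> x = b" and "a \<bullet> (x + y) = b"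
    unfolding eq[symmetric] by auto
  then have "a \<bullet> y = 0" by (simp add: inner_add_right)
  with ny have "y \<bullet> y = 0" by (simp add: y_def inner_diff_left)
  then have a: "a = r *\<^sub>R n" by (simp add: y_def)
  moreover from a ax \<open>n \<bullet> x = c\<close> have "b = r * c" by simp
  moreover from a \<open>a \<noteq> 0\<close> have "r \<noteq> 0" by auto
  ultimately show ?thesis using that by blast
qed

section \<open>Neurons gated by an element\<close>

text \<open>
The affine function computed by a first-layer neuron before activation. A neuron is indexed by a
hyperplane and a Boolean for the orientation, so that each hyperplane accounts for two neurons.
\<close>

definition hyperplane_neuron ::
  "('h \<Rightarrow> 'a::real_inner) \<Rightarrow> ('h \<Rightarrow> real) \<Rightarrow> 'h \<times> bool \<Rightarrow> 'a \<Rightarrow> real" where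
  "hyperplane_neuron n c q x = (if snd q then 1 else -1) * (n (fst q) \<bullet> x - c (fst q))"

text \<open>
Choosing the right one of the two orientations for each facet describes the open polytope by the
positivity of first-layer neurons, that is, by values of rho 0.
\<close>

lemma interior_from_hyperplane_signs:
  fixes P :: "'a::euclidean_space set"
  assumes P: "polytope P" and int: "interior P \<noteq> {}"
    and facets: "\<And>C. C facet_of P \<Longrightarrow> affine hull C \<in> H"
    and H: "\<And>h. h \<in> H \<Longrightarrow> n h \<noteq> 0 \<and> h = {x. n h \<bullet> x = c h}"
  obtains Q where "finite Q" "Q \<subseteq> H \<times> UNIV"
    "interior P = {x. \<forall>q\<in>Q. hyperplane_neuron n c q x > 0}"
    "span ((\<lambda>q. n (fst q)) ` Q) = UNIV"
proof -
  obtain F and a :: "'a set \<Rightarrow> 'a" and b where F: "finite F"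
    "interior P = {x. \<forall>f\<in>F. a f \<bullet> x < b f}"
    "\<And>f. f \<in> F \<Longrightarrow> a f \<noteq> 0"
    "\<And>f. f \<in> F \<Longrightarrow> \<exists>C. C facet_of P \<and> affine hull C = {x. a f \<bullet> x = b f}"
    "span (a ` F) = UNIV"
    by (rule polytope_facet_halfspaces[OF P int], rule that)
  have "\<exists>q r. q \<in> H \<times> UNIV \<and> a f = r *\<^sub>R n (fst q) \<and>
      (\<forall>x. a f \<bullet> x < b f \<longleftrightarrow> hyperplane_neuron n c q x > 0)" if f: "f \<in> F" for f
  proof -
    define h where "h = {x. a f \<bullet> x = b f}"
    have "h \<in> H" using F(4)[OF f] facets unfolding h_def by metis
    then have nh: "n h \<noteq> 0" "{x. a f \<bullet> x = b f} = {x. n h \<bullet> x = c h}"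
      using H[OF \<open>h \<in> H\<close>] by (simp_all flip: h_def)
    obtain r where r: "r \<noteq> 0" "a f = r *\<^sub>R n h" "b f = r * c h"
      using hyperplane_equations_proportional[OF nh(2) F(3)[OF f] nh(1)] .
    have "a f \<bullet> x < b f \<longleftrightarrow> hyperplane_neuron n c (h, r < 0) x > 0" for x
    proof -
      have "a f \<bullet> x < b f \<longleftrightarrow> r * (n h \<bullet> x - c h) < 0"
        by (simp add: r algebra_simps)
      also have "\<dots> \<longleftrightarrow> hyperplane_neuron n c (h, r < 0) x > 0"
        using r(1) by (auto simp: hyperplane_neuron_def mult_less_0_iff)
      finally show ?thesis .
    qed
    with \<open>h \<in> H\<close> r(2) show ?thesis
      by (intro exI[of _ "(h, r < 0)"] exI[of _ r]) auto
  qed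
  then obtain q r where qr: "\<And>f. f \<in> F \<Longrightarrow> q f \<in> H \<times> UNIV"
      "\<And>f. f \<in> F \<Longrightarrow> a f = r f *\<^sub>R n (fst (q f))"
      "\<And>f x. f \<in> F \<Longrightarrow> a f \<bullet> x < b f \<longleftrightarrow> hyperplane_neuron n c (q f) x > 0"
    by metis
  show ?thesis
  proof (rule that[of "q ` F"])
    have "a ` F \<subseteq> span ((\<lambda>q. n (fst q)) ` q ` F)"
    proof (clarify, unfold qr(2))
      fix f assume "f \<in> F"
      then show "r f *\<^sub>R n (fst (q f)) \<in> span ((\<lambda>q. n (fst q)) ` q ` F)"
        by (intro span_scale span_base imageI)
    qed
    then have "span (a ` F) \<subseteq> span ((\<lambda>q. n (fst q)) ` q ` F)"
      by (simp add: span_minimal)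
    then show "span ((\<lambda>q. n (fst q)) ` q ` F) = UNIV"
      using F(5) by auto
    show "finite (q ` F)" using F(1) by simp
    show "q ` F \<subseteq> H \<times> UNIV" using qr(1) by (rule image_subsetI)
    show "interior P = {x. \<forall>q\<in>q ` F. hyperplane_neuron n c q x > 0}"
      using F(2) qr(3) by simp
  qed
qed

lemma span_image_finiteE:
  fixes f :: "'i \<Rightarrow> 'a::real_vector"
  assumes "finite I" "x \<in> span (f ` I)"
  obtains w where "x = (\<Sum>i\<in>I. w i *\<^sub>R f i)"
proof -
  have "\<exists>w. x = (\<Sum>i\<in>I. w i *\<^sub>R f i)"
    using assms
  proof (induction I arbitrary: x rule: finite_induct)
    case (insert j I)
    then obtain r where "x - r *\<^sub>R f j \<in> span (f ` I)"
      by (auto simp: span_breakdown_eq)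
    then obtain w where "x - r *\<^sub>R f j = (\<Sum>i\<in>I. w i *\<^sub>R f i)"
      using insert.IH by blast
    moreover have "(\<Sum>i\<in>I. (w(j := r)) i *\<^sub>R f i) = (\<Sum>i\<in>I. w i *\<^sub>R f i)"
      using insert.hyps by (intro sum.cong) auto
    ultimately show ?case
      using insert.hyps by (intro exI[of _ "w(j := r)"]) (simp add: algebra_simps)
  qed simp
  then show ?thesis using that by blast
qed

text \<open>
The second-layer neuron. Let Q be the set of first-layer neurons whose positivity describes the
interior of P. The pre-activation is 1 + t.x minus twice the number of neurons in Q that are not
positive at x. The count comes from the rho 0 outputs. The affine function 1 + t.x comes from the
rho 1 outputs: the two orientations of a hyperplane together produce n.x - c, and the normals n span
the space. As 1 + t.x is positive and at most 2, the pre-activation equals 1 + t.x inside P and is at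
most 0 elsewhere. Strict positivity inside matters for k = 0, where rho is the indicator of the
positive numbers and must return 1.
\<close>

lemma gated_power_neuron:
  fixes P :: "'a::euclidean_space set"
  assumes P: "polytope P" and int: "interior P \<noteq> {}" and "finite H"
    and facets: "\<And>C. C facet_of P \<Longrightarrow> affine hull C \<in> H"
    and H: "\<And>h. h \<in> H \<Longrightarrow> n h \<noteq> 0 \<and> h = {x. n h \<bullet> x = c h}"
  shows "\<exists>W0 W1 \<beta>. \<forall>x. 0 < 1 + t \<bullet> x \<and> 1 + t \<bullet> x \<le> 2 \<longrightarrow>
    rho k ((\<Sum>q\<in>H \<times> UNIV. W0 q * rho 0 (hyperplane_neuron n c q x)) +
           (\<Sum>q\<in>H \<times> UNIV. W1 q * rho 1 (hyperplane_neuron n c q x)) + \<beta>) =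
      (if x \<in> interior P then (1 + t \<bullet> x) ^ k else 0)"
proof -
  obtain Q where Q: "finite Q" "Q \<subseteq> H \<times> UNIV"
    "interior P = {x. \<forall>q\<in>Q. hyperplane_neuron n c q x > 0}"
    "span ((\<lambda>q. n (fst q)) ` Q) = UNIV"
    by (rule interior_from_hyperplane_signs[OF P int facets H])
  have "(\<lambda>q. n (fst q)) ` Q \<subseteq> n ` H" using Q(2) by auto
  then have "t \<in> span (n ` H)"
    using span_mono[of "(\<lambda>q. n (fst q)) ` Q" "n ` H"] Q(4) by auto
  with \<open>finite H\<close> obtain w where w: "t = (\<Sum>h\<in>H. w h *\<^sub>R n h)"
    by (rule span_image_finiteE)
  define W0 where "W0 q = (if q \<in> Q then 2 else (0::real))" for q
  define W1 where "W1 q = (if snd q then w (fst q) else - w (fst q))" for q :: "'a set \<times> bool"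
  define \<beta> where "\<beta> = 1 + (\<Sum>h\<in>H. w h * c h) - 2 * real (card Q)"
  \<comment> \<open>The inequalities violated at x.\<close>
  define V where "V x = {q\<in>Q. \<not> hyperplane_neuron n c q x > 0}" for x
  have pre: "(\<Sum>q\<in>H \<times> UNIV. W0 q * rho 0 (hyperplane_neuron n c q x)) +
      (\<Sum>q\<in>H \<times> UNIV. W1 q * rho 1 (hyperplane_neuron n c q x)) + \<beta> =
      1 + t \<bullet> x - 2 * real (card (V x))" for x
  proof -
    have "(\<Sum>q\<in>H \<times> UNIV. W0 q * rho 0 (hyperplane_neuron n c q x)) =
        (\<Sum>q\<in>Q - V x. 2)"
      using Q(2) \<open>finite H\<close>
      by (intro sum.mono_neutral_cong_right) (auto simp: W0_def rho_def V_def)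
    also have "\<dots> = 2 * real (card Q) - 2 * real (card (V x))"
      using Q(1) by (simp add: V_def card_Diff_subset card_mono of_nat_diff)
    finally have 0: "(\<Sum>q\<in>H \<times> UNIV. W0 q * rho 0 (hyperplane_neuron n c q x)) =
        2 * real (card Q) - 2 * real (card (V x))" .
    have "(\<Sum>q\<in>H \<times> UNIV. W1 q * rho 1 (hyperplane_neuron n c q x)) =
        (\<Sum>h\<in>H. \<Sum>s\<in>UNIV. W1 (h, s) * rho 1 (hyperplane_neuron n c (h, s) x))"
      by (simp add: sum.cartesian_product)
    \<comment> \<open>For each hyperplane, the positive part minus the negative part is the signed value.\<close>
    also have "\<dots> = (\<Sum>h\<in>H. w h * (n h \<bullet> x - c h))"
      by (intro sum.cong)
        (auto simp: UNIV_bool W1_def rho_def hyperplane_neuron_def max_def algebra_simps)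
    also have "\<dots> = t \<bullet> x - (\<Sum>h\<in>H. w h * c h)"
      by (simp add: w inner_sum_left right_diff_distrib sum_subtractf)
    finally show ?thesis using 0 by (simp add: \<beta>_def)
  qed
  have "rho k (1 + t \<bullet> x - 2 * real (card (V x))) =
      (if x \<in> interior P then (1 + t \<bullet> x) ^ k else 0)"
    if "0 < 1 + t \<bullet> x" "1 + t \<bullet> x \<le> 2" for x
  proof (cases "x \<in> interior P")
    case True
    then have "V x = {}" using Q(3) by (auto simp: V_def)
    then show ?thesis using True that by (simp add: rho_def)
  next
    case False
    then have "V x \<noteq> {}" using Q(3) by (auto simp: V_def)
    moreover have "finite (V x)" using Q(1) by (simp add: V_def)
    ultimately have "real (card (V x)) \<ge> 1"
      by (simp add: Suc_le_eq card_gt_0_iff)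
    then show ?thesis using False that by (simp add: rho_def max_def)
  qed
  with pre show ?thesis
    by (intro exI[of _ W0] exI[of _ W1] exI[of _ \<beta>]) simp
qed

section \<open>Elements and hyperplanes of a mesh\<close>

lemma mesh_element:
  assumes "open_simplex (\<tau> :: (real ^ 'd) set)"
  shows "polytope (closure \<tau>)" "interior (closure \<tau>) = \<tau>" "\<tau> \<noteq> {}"
proof -
  obtain S where S: "int CARD('d) simplex S" "\<tau> = interior S"
    using assms by (auto simp: open_simplex_def)
  have "aff_dim S = DIM(real ^ 'd)"
    using aff_dim_simplex[OF S(1)] by simp
  then have "affine hull S = UNIV" by (simp only: aff_dim_eq_full)
  then have "interior S = rel_interior S" by (simp add: rel_interior_interior)
  moreover have "S \<noteq> {}" using S(1) by auto
  ultimately show ne: "\<tau> \<noteq> {}"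
    using S convex_simplex rel_interior_eq_empty by metis
  have "closure \<tau> = S"
    using convex_closure_interior[OF convex_simplex[OF S(1)]] ne S closed_simplex[OF S(1)]
    by simp
  then show "polytope (closure \<tau>)" "interior (closure \<tau>) = \<tau>"
    using S simplex_imp_polytope by auto
qed

lemma finite_facet_hyperplanes:
  assumes "conforming_mesh \<Omega> \<T>"
  shows "finite (facet_hyperplanes \<T>)"
proof -
  have "facet_hyperplanes \<T> = (\<Union>\<tau>\<in>\<T>. (hull) affine ` {F. F facet_of closure \<tau>})"
    by (auto simp: facet_hyperplanes_def)
  moreover have "finite {F. F facet_of closure \<tau>}" if "\<tau> \<in> \<T>" for \<tau>
    using assms mesh_element(1) that
    by (intro finite_polytope_facets) (auto simp: conforming_mesh_def)
  ultimately show ?thesis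
    using assms by (simp add: conforming_mesh_def)
qed

lemma facet_hyperplane_equations:
  assumes "conforming_mesh \<Omega> (\<T> :: (real ^ 'd) set set)"
  obtains n c where "\<And>h. h \<in> facet_hyperplanes \<T> \<Longrightarrow> n h \<noteq> 0 \<and> h = {x. n h \<bullet> x = c h}"
proof -
  have "\<exists>n c. n \<noteq> 0 \<and> h = {x. n \<bullet> x = c}" if h: "h \<in> facet_hyperplanes \<T>" for h
  proof -
    obtain F \<tau> where F: "h = affine hull F" "\<tau> \<in> \<T>" "F facet_of closure \<tau>"
      using h unfolding facet_hyperplanes_def by blast
    then have "aff_dim (closure \<tau>) = DIM(real ^ 'd)"
      using assms mesh_element[of \<tau>]
      by (intro aff_dim_nonempty_interior) (auto simp: conforming_mesh_def)
    then have "aff_dim F = DIM(real ^ 'd) - 1"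
      using F(3) by (simp add: facet_of_def)
    then show ?thesis
      using aff_dim_eq_hyperplane[of F] F(1) by auto
  qed
  then show ?thesis using that by metis
qed

lemma finite_enumeration:
  assumes "finite S"
  shows "\<exists>e. bij_betw e {..<card S} S"
  using ex_bij_betw_nat_finite[OF assms] by (simp add: atLeast0LessThan)

text \<open>
All parameters below are assembled from the mesh and the functions 1 + t p.x, before any output
coefficients W are given. The first layer is an enumeration of the oriented facet hyperplanes, the
second an enumeration of the pairs of an element and an index p, each of which carries a gated power
neuron; the output matrix is W read along the second enumeration.
\<close>

lemma hidden_parameters_for_mesh:
  fixes \<T> :: "(real ^ 'd) set set"
  assumes mesh: "conforming_mesh \<Omega> \<T>"
    and range: "\<And>p x. x \<in> closure \<Omega> \<Longrightarrow> 0 < 1 + t p \<bullet> x \<and> 1 + t p \<bullet> x \<le> 2"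
  obtains WI bI WII0 WII1 bII where
    "\<And>m W. \<exists>WIII. \<forall>x\<in>closure \<Omega>. \<forall>l<m.
       network m k (2 * card (facet_hyperplanes \<T>)) (M * card \<T>) WI bI WII0 WII1 bII WIII x l =
       (\<Sum>(\<tau>, p)\<in>\<T> \<times> {..<M}. W l \<tau> p * (if x \<in> \<tau> then (1 + t p \<bullet> x) ^ k else 0))"
proof -
  let ?H = "facet_hyperplanes \<T>"
  obtain n c where nc: "\<And>h. h \<in> ?H \<Longrightarrow> n h \<noteq> 0 \<and> h = {x. n h \<bullet> x = c h}"
    by (rule facet_hyperplane_equations[OF mesh], rule that)
  have finH: "finite ?H" by (rule finite_facet_hyperplanes[OF mesh])
  have finT: "finite \<T>" using mesh by (simp add: conforming_mesh_def)
  let ?z = "hyperplane_neuron n c"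
  define gates where "gates \<tau> p g \<longleftrightarrow> (\<forall>x\<in>closure \<Omega>.
      rho k ((\<Sum>q\<in>?H \<times> UNIV. fst g q * rho 0 (?z q x)) +
             (\<Sum>q\<in>?H \<times> UNIV. fst (snd g) q * rho 1 (?z q x)) + snd (snd g)) =
      (if x \<in> \<tau> then (1 + t p \<bullet> x) ^ k else 0))" for \<tau> p g
  have "\<exists>g. gates \<tau> p g" if \<tau>: "\<tau> \<in> \<T>" for \<tau> p
  proof -
    have el: "polytope (closure \<tau>)" "interior (closure \<tau>) = \<tau>" "\<tau> \<noteq> {}"
      using mesh_element[of \<tau>] mesh \<tau> by (auto simp: conforming_mesh_def)
    then have int: "interior (closure \<tau>) \<noteq> {}" by simp
    have facets: "affine hull C \<in> ?H" if "C facet_of closure \<tau>" for C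
      using that \<tau> by (auto simp: facet_hyperplanes_def)
    have "\<exists>W0 W1 \<beta>. \<forall>x. 0 < 1 + t p \<bullet> x \<and> 1 + t p \<bullet> x \<le> 2 \<longrightarrow>
      rho k ((\<Sum>q\<in>?H \<times> UNIV. W0 q * rho 0 (?z q x)) +
             (\<Sum>q\<in>?H \<times> UNIV. W1 q * rho 1 (?z q x)) + \<beta>) =
      (if x \<in> interior (closure \<tau>) then (1 + t p \<bullet> x) ^ k else 0)"
      by (rule gated_power_neuron[OF el(1) int finH]) (erule facets, erule nc)
    then obtain W0 W1 \<beta> where "\<forall>x. 0 < 1 + t p \<bullet> x \<and> 1 + t p \<bullet> x \<le> 2 \<longrightarrow>
      rho k ((\<Sum>q\<in>?H \<times> UNIV. W0 q * rho 0 (?z q x)) +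
             (\<Sum>q\<in>?H \<times> UNIV. W1 q * rho 1 (?z q x)) + \<beta>) =
      (if x \<in> interior (closure \<tau>) then (1 + t p \<bullet> x) ^ k else 0)"
      by (elim exE)
    then have "gates \<tau> p (W0, W1, \<beta>)"
      using range by (simp add: gates_def el(2))
    then show ?thesis by (rule exI)
  qed
  then obtain G where "\<And>\<tau> p. \<tau> \<in> \<T> \<Longrightarrow> gates \<tau> p (G \<tau> p)"
    by metis
  then have gate: "rho k ((\<Sum>q\<in>?H \<times> UNIV. fst (G \<tau> p) q * rho 0 (?z q x)) +
             (\<Sum>q\<in>?H \<times> UNIV. fst (snd (G \<tau> p)) q * rho 1 (?z q x)) + snd (snd (G \<tau> p))) =
      (if x \<in> \<tau> then (1 + t p \<bullet> x) ^ k else 0)"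
    if "\<tau> \<in> \<T>" "x \<in> closure \<Omega>" for \<tau> p x
    using that by (simp add: gates_def)
  have "\<exists>e. bij_betw e {..<2 * card ?H} (?H \<times> (UNIV :: bool set))"
    using finite_enumeration[of "?H \<times> (UNIV :: bool set)"] finH
    by (simp add: card_cartesian_product mult.commute)
  then obtain e1 where e1: "bij_betw e1 {..<2 * card ?H} (?H \<times> (UNIV :: bool set))"
    by (rule exE)
  have "\<exists>e. bij_betw e {..<M * card \<T>} (\<T> \<times> {..<M})"
    using finite_enumeration[of "\<T> \<times> {..<M}"] finT
    by (simp add: card_cartesian_product mult.commute)
  then obtain e2 where e2: "bij_betw e2 {..<M * card \<T>} (\<T> \<times> {..<M})"
    by (rule exE)
  define sg where "sg j = (if snd (e1 j) then 1 else - 1 :: real)" for j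
  define WI where "WI j = sg j *\<^sub>R n (fst (e1 j))" for j
  define bI where "bI j = - sg j * c (fst (e1 j))" for j
  define WII0 where "WII0 i j = fst (G (fst (e2 i)) (snd (e2 i))) (e1 j)" for i j
  define WII1 where "WII1 i j = fst (snd (G (fst (e2 i)) (snd (e2 i)))) (e1 j)" for i j
  define bII where "bII i = snd (snd (G (fst (e2 i)) (snd (e2 i))))" for i
  have first: "WI j \<bullet> x + bI j = ?z (e1 j) x" for j x
    by (simp add: WI_def bI_def sg_def hyperplane_neuron_def algebra_simps)
  show ?thesis
  proof (rule that[of WI bI WII0 WII1 bII])
    fix m and W :: "nat \<Rightarrow> (real ^ 'd) set \<Rightarrow> nat \<Rightarrow> real"
    define WIII where "WIII l i = W l (fst (e2 i)) (snd (e2 i))" for l i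
    have "network m k (2 * card ?H) (M * card \<T>) WI bI WII0 WII1 bII WIII x l =
        (\<Sum>(\<tau>, p)\<in>\<T> \<times> {..<M}. W l \<tau> p * (if x \<in> \<tau> then (1 + t p \<bullet> x) ^ k else 0))"
      if x: "x \<in> closure \<Omega>" and l: "l < m" for x l
    proof -
      have "network m k (2 * card ?H) (M * card \<T>) WI bI WII0 WII1 bII WIII x l =
          (\<Sum>i<M * card \<T>. WIII l i *
            rho k ((\<Sum>j<2 * card ?H. WII0 i j * rho 0 (?z (e1 j) x)) +
                   (\<Sum>j<2 * card ?H. WII1 i j * rho 1 (?z (e1 j) x)) + bII i))"
        using l by (simp add: network_def first)
      also have "\<dots> = (\<Sum>i<M * card \<T>. W l (fst (e2 i)) (snd (e2 i)) *
          (if x \<in> fst (e2 i) then (1 + t (snd (e2 i)) \<bullet> x) ^ k else 0))"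
      proof (rule sum.cong[OF refl])
        fix i assume "i \<in> {..<M * card \<T>}"
        then have "e2 i \<in> \<T> \<times> {..<M}" using e2 by (auto simp: bij_betw_def)
        then have \<tau>: "fst (e2 i) \<in> \<T>" by auto
        have "(\<Sum>j<2 * card ?H. WII0 i j * rho 0 (?z (e1 j) x)) =
            (\<Sum>q\<in>?H \<times> UNIV. fst (G (fst (e2 i)) (snd (e2 i))) q * rho 0 (?z q x))"
          unfolding WII0_def by (rule sum.reindex_bij_betw[OF e1])
        moreover have "(\<Sum>j<2 * card ?H. WII1 i j * rho 1 (?z (e1 j) x)) =
            (\<Sum>q\<in>?H \<times> UNIV. fst (snd (G (fst (e2 i)) (snd (e2 i)))) q * rho 1 (?z q x))"
          unfolding WII1_def by (rule sum.reindex_bij_betw[OF e1])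
        ultimately show "WIII l i *
            rho k ((\<Sum>j<2 * card ?H. WII0 i j * rho 0 (?z (e1 j) x)) +
                   (\<Sum>j<2 * card ?H. WII1 i j * rho 1 (?z (e1 j) x)) + bII i) =
            W l (fst (e2 i)) (snd (e2 i)) *
            (if x \<in> fst (e2 i) then (1 + t (snd (e2 i)) \<bullet> x) ^ k else 0)"
          using gate[OF \<tau> x, of "snd (e2 i)"] by (simp only: WIII_def bII_def)
      qed
      also have "\<dots> = (\<Sum>r\<in>\<T> \<times> {..<M}. W l (fst r) (snd r) *
          (if x \<in> fst r then (1 + t (snd r) \<bullet> x) ^ k else 0))"
        by (rule sum.reindex_bij_betw[OF e2])
      finally show ?thesis by (simp only: case_prod_unfold)
    qed
    then show "\<exists>WIII. \<forall>x\<in>closure \<Omega>. \<forall>l<m.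
        network m k (2 * card ?H) (M * card \<T>) WI bI WII0 WII1 bII WIII x l =
        (\<Sum>(\<tau>, p)\<in>\<T> \<times> {..<M}. W l \<tau> p * (if x \<in> \<tau> then (1 + t p \<bullet> x) ^ k else 0))"
      by (intro exI[of _ WIII] ballI allI impI)
  qed
qed

section \<open>Expansion of discontinuous Galerkin functions\<close>

text \<open>
A vector-valued polynomial is expanded twice, its coefficients in the basis b of E and its monomials
in the functions g p; exchanging the sums collects one scalar for each pair (l, p).
\<close>

lemma polynomial_on_coordinates:
  fixes v :: "real ^ 'd \<Rightarrow> 'e::real_vector"
  assumes v: "polynomial_on k \<tau> E v" and b: "is_basis m b E"
    and q: "\<And>\<alpha> x. \<alpha> \<in> multi_indices k \<Longrightarrow> monomial_fun \<alpha> x = (\<Sum>p<M. q \<alpha> p * g p x)"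
  shows "\<exists>w. \<forall>x\<in>\<tau>. v x = (\<Sum>l<m. (\<Sum>p<M. w l p * g p x) *\<^sub>R b l)"
proof -
  obtain c where c: "\<And>\<alpha>. \<alpha> \<in> multi_indices k \<Longrightarrow> c \<alpha> \<in> E"
    "\<And>x. x \<in> \<tau> \<Longrightarrow> v x = (\<Sum>\<alpha>\<in>multi_indices k. monomial_fun \<alpha> x *\<^sub>R c \<alpha>)"
    using v by (auto simp: polynomial_on_def monomial_fun_def)
  have "\<exists>y. c \<alpha> = (\<Sum>l<m. y l *\<^sub>R b l)" if "\<alpha> \<in> multi_indices k" for \<alpha>
    using span_image_finiteE[of "{..<m}" "c \<alpha>" b] c(1)[OF that] b
    by (auto simp: is_basis_def)
  then obtain y where y: "\<And>\<alpha>. \<alpha> \<in> multi_indices k \<Longrightarrow> c \<alpha> = (\<Sum>l<m. y \<alpha> l *\<^sub>R b l)"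
    by metis
  have "v x = (\<Sum>l<m. (\<Sum>p<M. (\<Sum>\<alpha>\<in>multi_indices k. q \<alpha> p * y \<alpha> l) * g p x) *\<^sub>R b l)"
    if "x \<in> \<tau>" for x
  proof -
    have "v x = (\<Sum>\<alpha>\<in>multi_indices k. \<Sum>l<m. (\<Sum>p<M. q \<alpha> p * y \<alpha> l * g p x) *\<^sub>R b l)"
      unfolding c(2)[OF that]
      by (intro sum.cong refl) (simp add: y q scaleR_sum_right sum_distrib_right sum_distrib_left mult_ac)
    also have "\<dots> = (\<Sum>l<m. (\<Sum>\<alpha>\<in>multi_indices k. \<Sum>p<M. q \<alpha> p * y \<alpha> l * g p x) *\<^sub>R b l)"
      by (subst sum.swap) (simp add: scaleR_sum_left)
    also have "(\<lambda>l. \<Sum>\<alpha>\<in>multi_indices k. \<Sum>p<M. q \<alpha> p * y \<alpha> l * g p x) =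
        (\<lambda>l. \<Sum>p<M. (\<Sum>\<alpha>\<in>multi_indices k. q \<alpha> p * y \<alpha> l) * g p x)"
      by (subst sum.swap) (simp add: sum_distrib_right)
    finally show ?thesis .
  qed
  then show ?thesis
    by (intro exI[of _ "\<lambda>l p. \<Sum>\<alpha>\<in>multi_indices k. q \<alpha> p * y \<alpha> l"] ballI)
qed

text \<open>
A point of the closure of the domain lies in at most one element, because elements are disjoint. If
it lies in one, only the summand of that element survives; if it lies in none, it is on the boundary
of an element, where v vanishes as the right-hand side does.
\<close>

lemma DG_space_expansion:
  fixes v :: "real ^ 'd \<Rightarrow> 'e::real_vector"
  assumes mesh: "conforming_mesh \<Omega> \<T>" and b: "is_basis m b E" and v: "v \<in> DG_space k \<Omega> \<T> E"
    and q: "\<And>\<alpha> x. \<alpha> \<in> multi_indices k \<Longrightarrow> monomial_fun \<alpha> x = (\<Sum>p<M. q \<alpha> p * g p x)"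
  shows "\<exists>W. \<forall>x\<in>closure \<Omega>. v x =
    (\<Sum>l<m. (\<Sum>(\<tau>, p)\<in>\<T> \<times> {..<M}. W l \<tau> p * (if x \<in> \<tau> then g p x else 0)) *\<^sub>R b l)"
proof -
  have "\<forall>\<tau>\<in>\<T>. \<exists>w. \<forall>x\<in>\<tau>. v x = (\<Sum>l<m. (\<Sum>p<M. w l p * g p x) *\<^sub>R b l)"
  proof
    fix \<tau> assume "\<tau> \<in> \<T>"
    then have "polynomial_on k \<tau> E v" using v by (simp add: DG_space_def)
    then show "\<exists>w. \<forall>x\<in>\<tau>. v x = (\<Sum>l<m. (\<Sum>p<M. w l p * g p x) *\<^sub>R b l)"
      by (rule polynomial_on_coordinates[where q = q, OF _ b q])
  qed
  from bchoice[OF this] obtain w where "\<forall>\<tau>\<in>\<T>. \<forall>x\<in>\<tau>.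
      v x = (\<Sum>l<m. (\<Sum>p<M. w \<tau> l p * g p x) *\<^sub>R b l)"
    by (rule exE)
  note w = this[rule_format]
  have finT: "finite \<T>"
    and disjoint: "\<And>\<tau> \<sigma>. \<tau> \<in> \<T> \<Longrightarrow> \<sigma> \<in> \<T> \<Longrightarrow> \<tau> \<noteq> \<sigma> \<Longrightarrow> \<tau> \<inter> \<sigma> = {}"
    and cover: "(\<Union>\<tau>\<in>\<T>. closure \<tau>) = closure \<Omega>"
    using mesh by (simp_all add: conforming_mesh_def)
  have "v x = (\<Sum>l<m. (\<Sum>(\<tau>, p)\<in>\<T> \<times> {..<M}. w \<tau> l p * (if x \<in> \<tau> then g p x else 0)) *\<^sub>R b l)"
    if x: "x \<in> closure \<Omega>" for x
  proof -
    have split: "(\<Sum>(\<tau>, p)\<in>\<T> \<times> {..<M}. w \<tau> l p * (if x \<in> \<tau> then g p x else 0)) =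
        (\<Sum>\<tau>\<in>\<T>. if x \<in> \<tau> then \<Sum>p<M. w \<tau> l p * g p x else 0)" for l
      unfolding sum.cartesian_product[symmetric] by (intro sum.cong) auto
    show ?thesis
    proof (cases "\<exists>\<sigma>\<in>\<T>. x \<in> \<sigma>")
      case True
      then obtain \<sigma> where \<sigma>: "\<sigma> \<in> \<T>" "x \<in> \<sigma>" by blast
      have "x \<in> \<tau> \<longleftrightarrow> \<tau> = \<sigma>" if "\<tau> \<in> \<T>" for \<tau>
        using disjoint[OF that \<sigma>(1)] \<sigma>(2) by auto
      then have "(\<Sum>\<tau>\<in>\<T>. if x \<in> \<tau> then \<Sum>p<M. w \<tau> l p * g p x else 0) =
          (\<Sum>\<tau>\<in>\<T>. if \<tau> = \<sigma> then \<Sum>p<M. w \<tau> l p * g p x else 0)" for l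
        by (intro sum.cong) auto
      with \<sigma>(1) finT have "(\<Sum>\<tau>\<in>\<T>. if x \<in> \<tau> then \<Sum>p<M. w \<tau> l p * g p x else 0) =
          (\<Sum>p<M. w \<sigma> l p * g p x)" for l
        by simp
      then show ?thesis unfolding split using w[OF \<sigma>] by simp
    next
      case False
      obtain \<tau> where \<tau>: "\<tau> \<in> \<T>" "x \<in> closure \<tau>"
        using cover x by blast
      then have "x \<in> skeleton \<T>"
        using False by (auto simp: skeleton_def frontier_def dest: interior_subset[THEN subsetD])
      then have "v x = 0" using v by (simp add: DG_space_def)
      then show ?thesis unfolding split using False by (simp add: sum.neutral)
    qed
  qed
  then show ?thesis by (intro exI[of _ "\<lambda>l \<tau> p. w \<tau> l p"] ballI)
qed

section \<open>Realization by a network\<close>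

text \<open>
The hidden parameters are fixed from a bound R of the domain: with coordinates of t in [0, \<epsilon>] the
scalar product t.x has absolute value at most d \<epsilon> R on the domain, and the choice of \<epsilon> makes this
smaller than 1, as gating requires.
\<close>

lemma DG_network_hidden_parameters:
  fixes \<Omega> :: "(real ^ 'd) set"
  assumes poly: "bounded_open_polyhedral \<Omega>" and mesh: "conforming_mesh \<Omega> \<T>"
  shows "\<exists>WI bI WII0 WII1 bII.
        \<forall>m E. \<forall>b :: nat \<Rightarrow> 'e::real_vector. m \<ge> 1 \<and> is_basis m b E \<longrightarrow>
          (\<forall>v\<in>DG_space k \<Omega> \<T> E. \<exists>WIII. \<forall>x\<in>closure \<Omega>.
             v x = (\<Sum>l<m. network m k (2 * card (facet_hyperplanes \<T>))
                             (((CARD('d) + k) choose CARD('d)) * card \<T>)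
                             WI bI WII0 WII1 bII WIII x l *\<^sub>R b l))"
proof -
  let ?M = "(CARD('d) + k) choose CARD('d)"
  have "bounded \<Omega>"
    using poly unfolding bounded_open_polyhedral_def by (rule conjunct1)
  then have "bounded (closure \<Omega>)" by (rule bounded_closure)
  then obtain R where R: "R > 0" "\<And>x. x \<in> closure \<Omega> \<Longrightarrow> norm x \<le> R"
    by (auto simp: bounded_pos)
  define \<epsilon> where "\<epsilon> = 1 / (real CARD('d) * (R + 1))"
  have "\<epsilon> > 0" using R(1) by (simp add: \<epsilon>_def)
  obtain t :: "nat \<Rightarrow> real ^ 'd" and q where
    t: "\<And>p i. 0 \<le> t p $ i \<and> t p $ i \<le> \<epsilon>" and
    q: "\<And>\<alpha> x. \<alpha> \<in> multi_indices k \<Longrightarrow>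
      monomial_fun \<alpha> x = (\<Sum>p<?M. q \<alpha> p * (1 + t p \<bullet> x) ^ k)"
    by (rule monomials_from_few_affine_powers[OF \<open>\<epsilon> > 0\<close>, of k], rule that)
  have range: "0 < 1 + t p \<bullet> x \<and> 1 + t p \<bullet> x \<le> 2" if "x \<in> closure \<Omega>" for p x
  proof -
    have "norm (t p) \<le> (\<Sum>i\<in>UNIV. \<bar>t p $ i\<bar>)" by (rule norm_le_l1_cart)
    also have "\<dots> \<le> (\<Sum>i\<in>(UNIV :: 'd set). \<epsilon>)"
      using t by (intro sum_mono) (simp add: abs_of_nonneg)
    also have "\<dots> = 1 / (R + 1)" by (simp add: \<epsilon>_def)
    finally have "norm (t p) * norm x \<le> 1 / (R + 1) * R"
      using R that by (intro mult_mono) auto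
    also have "\<dots> < 1" using R(1) by (simp add: field_simps)
    finally have "\<bar>t p \<bullet> x\<bar> < 1"
      using Cauchy_Schwarz_ineq2[of "t p" x] by linarith
    then show ?thesis by linarith
  qed
  obtain WI bI WII0 WII1 bII where net:
    "\<And>m W. \<exists>WIII. \<forall>x\<in>closure \<Omega>. \<forall>l<m.
       network m k (2 * card (facet_hyperplanes \<T>)) (?M * card \<T>) WI bI WII0 WII1 bII WIII x l =
       (\<Sum>(\<tau>, p)\<in>\<T> \<times> {..<?M}. W l \<tau> p * (if x \<in> \<tau> then (1 + t p \<bullet> x) ^ k else 0))"
    by (rule hidden_parameters_for_mesh[OF mesh range, of k ?M], assumption, rule that)
  show ?thesis
  proof (rule exI[of _ WI], rule exI[of _ bI], rule exI[of _ WII0], rule exI[of _ WII1],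
      rule exI[of _ bII], intro allI impI ballI)
    fix m E and b :: "nat \<Rightarrow> 'e" and v
    assume b: "m \<ge> 1 \<and> is_basis m b E" and v: "v \<in> DG_space k \<Omega> \<T> E"
    have "\<exists>W. \<forall>x\<in>closure \<Omega>. v x = (\<Sum>l<m. (\<Sum>(\<tau>, p)\<in>\<T> \<times> {..<?M}.
        W l \<tau> p * (if x \<in> \<tau> then (1 + t p \<bullet> x) ^ k else 0)) *\<^sub>R b l)"
      by (rule DG_space_expansion[where q = q, OF mesh conjunct2[OF b] v q])
    then obtain W where W: "\<forall>x\<in>closure \<Omega>. v x = (\<Sum>l<m. (\<Sum>(\<tau>, p)\<in>\<T> \<times> {..<?M}.
        W l \<tau> p * (if x \<in> \<tau> then (1 + t p \<bullet> x) ^ k else 0)) *\<^sub>R b l)"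
      by (rule exE)
    obtain WIII where WIII: "\<forall>x\<in>closure \<Omega>. \<forall>l<m.
       network m k (2 * card (facet_hyperplanes \<T>)) (?M * card \<T>) WI bI WII0 WII1 bII WIII x l =
       (\<Sum>(\<tau>, p)\<in>\<T> \<times> {..<?M}. W l \<tau> p * (if x \<in> \<tau> then (1 + t p \<bullet> x) ^ k else 0))"
      using net[of m W] by (rule exE)
    show "\<exists>WIII. \<forall>x\<in>closure \<Omega>. v x =
        (\<Sum>l<m. network m k (2 * card (facet_hyperplanes \<T>)) (?M * card \<T>)
           WI bI WII0 WII1 bII WIII x l *\<^sub>R b l)"
      by (intro exI[of _ WIII] ballI) (use W WIII in \<open>auto intro!: sum.cong\<close>)
  qed
qed

theorem corollary5:
  fixes k :: nat and \<Omega> :: "(real ^ 'd) set" and \<T> :: "(real ^ 'd) set set"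
  assumes "bounded_open_polyhedral \<Omega>" and "conforming_mesh \<Omega> \<T>"
  shows
    "(\<forall>m E. \<forall>b :: nat \<Rightarrow> 'e::real_vector. m \<ge> 1 \<and> is_basis m b E \<longrightarrow>
        (\<forall>v\<in>DG_space k \<Omega> \<T> E.
           \<exists>f\<in>NN m k (2 * card (facet_hyperplanes \<T>)) (((CARD('d) + k) choose CARD('d)) * card \<T>).
             \<forall>x\<in>closure \<Omega>. v x = (\<Sum>l<m. f x l *\<^sub>R b l))) \<and>
     (\<exists>WI bI WII0 WII1 bII.
        \<forall>m E. \<forall>b :: nat \<Rightarrow> 'e. m \<ge> 1 \<and> is_basis m b E \<longrightarrow>
          (\<forall>v\<in>DG_space k \<Omega> \<T> E. \<exists>WIII. \<forall>x\<in>closure \<Omega>.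
             v x = (\<Sum>l<m. network m k (2 * card (facet_hyperplanes \<T>))
                             (((CARD('d) + k) choose CARD('d)) * card \<T>)
                             WI bI WII0 WII1 bII WIII x l *\<^sub>R b l)))"
    (is "?realization \<and> (\<exists>WI bI WII0 WII1 bII. ?hidden WI bI WII0 WII1 bII)")
proof -
  obtain WI bI WII0 WII1 bII where hidden: "?hidden WI bI WII0 WII1 bII"
    using DG_network_hidden_parameters[OF assms, where k = k and 'e = 'e] by (elim exE)
  have ?realization
  proof (intro allI impI ballI)
    fix m E and b :: "nat \<Rightarrow> 'e" and v
    assume b: "m \<ge> 1 \<and> is_basis m b E" and v: "v \<in> DG_space k \<Omega> \<T> E"
    obtain WIII where "\<forall>x\<in>closure \<Omega>.
        v x = (\<Sum>l<m. network m k (2 * card (facet_hyperplanes \<T>))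
          (((CARD('d) + k) choose CARD('d)) * card \<T>) WI bI WII0 WII1 bII WIII x l *\<^sub>R b l)"
      using bspec[OF mp[OF spec[OF spec[OF spec[OF hidden]]] b] v] by (rule exE)
    moreover have "network m k (2 * card (facet_hyperplanes \<T>))
        (((CARD('d) + k) choose CARD('d)) * card \<T>) WI bI WII0 WII1 bII WIII
      \<in> NN m k (2 * card (facet_hyperplanes \<T>)) (((CARD('d) + k) choose CARD('d)) * card \<T>)"
      unfolding NN_def by blast
    ultimately show "\<exists>f\<in>NN m k (2 * card (facet_hyperplanes \<T>))
        (((CARD('d) + k) choose CARD('d)) * card \<T>).
          \<forall>x\<in>closure \<Omega>. v x = (\<Sum>l<m. f x l *\<^sub>R b l)"
      by (rule bexI)
  qed
  then show ?thesis using hidden by (intro conjI exI)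
qed

end
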